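(* Let $M$ be a surjunctive monoid and let $K$ be a field. Then the monoid algebra $K[M]$ is stably finite.
   Context: A monoid is a set with an associative binary operation and an identity element. For a set $A$, $A^M$ is the set of all maps $c\colon M\to A$. For $m\in M$, $R_m\colon M\to M$ is right multiplication, $R_m(x)=xm$; for $S\subset M$ and $c\in A^M$, $c|_S\in A^S$ is the restriction of $c$ to $S$. A map $\tau\colon A^M\to A^M$ is a cellular automaton over $(M,A)$ if there exist a finite subset $S\subset M$ and a map $\mu\colon A^S\to A$ such that $\tau(c)(m)=\mu\big((c\circ R_m)|_S\big)$ for all $c\in A^M$ and $m\in M$. The monoid $M$ is surjunctive if, for every finite set $A$, every injective cellular automaton $\tau\colon A^M\to A^M$ is surjective. The monoid algebra $K[M]$ is the $K$-algebra with $K$-vector space basis $M$ whose multiplication extends the monoid operation of $M$ $K$-linearly. Rings are associative with $1$. A ring $R$ is directly finite if $ab=1$ implies $ba=1$ for all $a,b\in R$; it is stably finite if the ring $\mathrm{Mat}_d(R)$ of $d\times d$ matrices with entries in $R$ is directly finite for every integer $d\ge 1$. *)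

theory Defs
  imports
    "HOL-Library.FuncSet"
    "HOL-Library.Poly_Mapping"
    "Jordan_Normal_Form.Matrix"
begin

text \<open>
  The monoid \<open>M\<close> is a type \<open>'m\<close> of class \<^class>\<open>monoid_add\<close>, which does not assume commutativity.
  It is written additively because \<^theory>\<open>HOL-Library.Poly_Mapping\<close> provides the monoid algebra
  \<open>K[M]\<close>, as the type \<open>'m \<Rightarrow>\<^sub>0 'k\<close> of finitely supported maps with convolution as
  multiplication, for index types of that class: the basis element for \<open>m\<close> is
  \<open>Poly_Mapping.single m 1\<close>, see \<open>mult_single\<close> and \<open>single_one\<close>. So \<open>x m\<close> becomes
  \<open>x + m\<close> and the identity becomes \<open>0\<close>.
\<close>

definition right_mult :: "'m::monoid_add \<Rightarrow> 'm \<Rightarrow> 'm" where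
  "right_mult m = (\<lambda>x. x + m)"

text \<open>
  \<open>A\<^sup>M\<close> is \<open>UNIV \<rightarrow> A\<close> and, for \<open>S\<close> a subset of \<open>M\<close>, \<open>A\<^sup>S\<close> is the set \<open>S \<rightarrow>\<^sub>E A\<close> of extensional
  functions. The values of \<open>\<tau>\<close> outside \<open>UNIV \<rightarrow> A\<close> are irrelevant.
\<close>

definition cellular_automaton ::
  "'a set \<Rightarrow> (('m::monoid_add \<Rightarrow> 'a) \<Rightarrow> ('m \<Rightarrow> 'a)) \<Rightarrow> bool" where
  "cellular_automaton A \<tau> \<longleftrightarrow>
     \<tau> \<in> (UNIV \<rightarrow> A) \<rightarrow> (UNIV \<rightarrow> A) \<and>
     (\<exists>S \<mu>. finite S \<and> \<mu> \<in> (S \<rightarrow>\<^sub>E A) \<rightarrow> A \<and>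
       (\<forall>c \<in> UNIV \<rightarrow> A. \<forall>m. \<tau> c m = \<mu> (restrict (c \<circ> right_mult m) S)))"

text \<open>
  A definition cannot quantify over the type of the alphabet. Every finite set is in bijection
  with a finite set of natural numbers, so these suffice; lemma \<open>surjunctiveD\<close> below is the
  property for finite alphabets in an arbitrary type.
\<close>

definition surjunctive :: "'m::monoid_add itself \<Rightarrow> bool" where
  "surjunctive M \<longleftrightarrow>
     (\<forall>(A :: nat set) (\<tau> :: ('m \<Rightarrow> nat) \<Rightarrow> ('m \<Rightarrow> nat)).
        finite A \<longrightarrow> cellular_automaton A \<tau> \<longrightarrow> inj_on \<tau> (UNIV \<rightarrow> A) \<longrightarrow>
        \<tau> ` (UNIV \<rightarrow> A) = (UNIV \<rightarrow> A))"

definition directly_finite :: "('r, 'b) ring_scheme \<Rightarrow> bool" where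
  "directly_finite R \<longleftrightarrow>
     (\<forall>a \<in> carrier R. \<forall>b \<in> carrier R. a \<otimes>\<^bsub>R\<^esub> b = \<one>\<^bsub>R\<^esub> \<longrightarrow> b \<otimes>\<^bsub>R\<^esub> a = \<one>\<^bsub>R\<^esub>)"

text \<open>The last argument \<open>()\<close> of \<^const>\<open>ring_mat\<close> fills the extension slot of the ring record.\<close>

definition stably_finite :: "'r::ring_1 itself \<Rightarrow> bool" where
  "stably_finite R \<longleftrightarrow> (\<forall>d \<ge> 1. directly_finite (ring_mat R d ()))"

lemma surjunctiveD:
  fixes A :: "'a set" and \<tau> :: "('m::monoid_add \<Rightarrow> 'a) \<Rightarrow> ('m \<Rightarrow> 'a)"
  assumes surj: "surjunctive TYPE('m)" and fin: "finite A"
    and ca: "cellular_automaton A \<tau>" and inj: "inj_on \<tau> (UNIV \<rightarrow> A)"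
  shows "\<tau> ` (UNIV \<rightarrow> A) = (UNIV \<rightarrow> A)"
proof -
  obtain f :: "'a \<Rightarrow> nat" where f: "inj_on f A"
    using fin finite_imp_inj_to_nat_seg by blast
  define B where "B = f ` A"
  define g where "g = inv_into A f"
  have gf: "g (f a) = a" if "a \<in> A" for a using f that by (simp add: g_def)
  have fg: "f (g b) = b" if "b \<in> B" for b
    using that by (simp add: g_def B_def f_inv_into_f)
  have fA: "f a \<in> B" if "a \<in> A" for a using that by (simp add: B_def)
  have gB: "g b \<in> A" if "b \<in> B" for b using that gf by (auto simp: B_def)
  from ca obtain S \<mu> where S: "finite S" and \<mu>: "\<mu> \<in> (S \<rightarrow>\<^sub>E A) \<rightarrow> A"
    and \<tau>: "\<tau> \<in> (UNIV \<rightarrow> A) \<rightarrow> (UNIV \<rightarrow> A)"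
    and eq: "\<And>c m. c \<in> UNIV \<rightarrow> A \<Longrightarrow> \<tau> c m = \<mu> (restrict (c \<circ> right_mult m) S)"
    unfolding cellular_automaton_def by blast
  have \<tau>A: "\<tau> c m \<in> A" if "\<And>x. c x \<in> A" for c m using \<tau> that by blast
  define \<sigma> where "\<sigma> c = f \<circ> \<tau> (g \<circ> c)" for c :: "'m \<Rightarrow> nat"
  have "cellular_automaton B \<sigma>"
    unfolding cellular_automaton_def
  proof (intro conjI exI[of _ S] exI[of _ "\<lambda>d. f (\<mu> (restrict (g \<circ> d) S))"] ballI allI S)
    show "\<sigma> \<in> (UNIV \<rightarrow> B) \<rightarrow> (UNIV \<rightarrow> B)"
      by (auto simp: \<sigma>_def Pi_iff intro!: fA \<tau>A gB)
    show "(\<lambda>d. f (\<mu> (restrict (g \<circ> d) S))) \<in> (S \<rightarrow>\<^sub>E B) \<rightarrow> B"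
    proof
      fix d assume d: "d \<in> S \<rightarrow>\<^sub>E B"
      have "restrict (g \<circ> d) S \<in> S \<rightarrow>\<^sub>E A" using d gB by (auto simp: PiE_iff)
      with \<mu> fA show "f (\<mu> (restrict (g \<circ> d) S)) \<in> B" by blast
    qed
    fix c m assume c: "c \<in> (UNIV :: 'm set) \<rightarrow> B"
    have "g \<circ> c \<in> UNIV \<rightarrow> A" using c gB by (simp add: Pi_iff)
    moreover have "restrict (g \<circ> restrict (c \<circ> right_mult m) S) S
        = restrict ((g \<circ> c) \<circ> right_mult m) S" by (auto simp: restrict_def)
    ultimately show "\<sigma> c m = f (\<mu> (restrict (g \<circ> restrict (c \<circ> right_mult m) S) S))"
      by (simp add: \<sigma>_def eq)
  qed
  moreover have "inj_on \<sigma> (UNIV \<rightarrow> B)"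
  proof (rule inj_onI)
    fix c d assume c: "c \<in> UNIV \<rightarrow> B" and d: "d \<in> UNIV \<rightarrow> B" and e: "\<sigma> c = \<sigma> d"
    have gc: "g \<circ> c \<in> UNIV \<rightarrow> A" and gd: "g \<circ> d \<in> UNIV \<rightarrow> A" using c d gB by (simp_all add: Pi_iff)
    have "\<tau> (g \<circ> c) m = \<tau> (g \<circ> d) m" for m
    proof -
      have "f (\<tau> (g \<circ> c) m) = f (\<tau> (g \<circ> d) m)" using fun_cong[OF e, of m] by (simp add: \<sigma>_def)
      moreover have "\<tau> (g \<circ> c) m \<in> A" "\<tau> (g \<circ> d) m \<in> A" using gc gd \<tau> by blast+
      ultimately show ?thesis using f by (meson inj_onD)
    qed
    then have "\<tau> (g \<circ> c) = \<tau> (g \<circ> d)" by (rule ext)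
    then have "g \<circ> c = g \<circ> d" using inj gc gd by (meson inj_onD)
    then have "f (g (c m)) = f (g (d m))" for m by (metis comp_apply)
    then show "c = d" using c d fg by (auto simp: fun_eq_iff Pi_iff)
  qed
  moreover have "finite B" using fin by (simp add: B_def)
  ultimately have \<sigma>: "\<sigma> ` (UNIV \<rightarrow> B) = (UNIV \<rightarrow> B)"
    using surj unfolding surjunctive_def by blast
  show ?thesis
  proof
    show "\<tau> ` (UNIV \<rightarrow> A) \<subseteq> UNIV \<rightarrow> A" using \<tau> by blast
    show "UNIV \<rightarrow> A \<subseteq> \<tau> ` (UNIV \<rightarrow> A)"
    proof
      fix y assume y: "y \<in> (UNIV :: 'm set) \<rightarrow> A"
      have "f \<circ> y \<in> UNIV \<rightarrow> B" using y fA by (simp add: Pi_iff)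
      then obtain c where c: "c \<in> UNIV \<rightarrow> B" and e: "f \<circ> y = \<sigma> c" using \<sigma> by blast
      have gc: "g \<circ> c \<in> UNIV \<rightarrow> A" using c gB by (simp add: Pi_iff)
      have "y m = \<tau> (g \<circ> c) m" for m
      proof -
        have "f (y m) = f (\<tau> (g \<circ> c) m)" using fun_cong[OF e, of m] by (simp add: \<sigma>_def)
        moreover have "y m \<in> A" "\<tau> (g \<circ> c) m \<in> A" using y gc \<tau> by blast+
        ultimately show ?thesis using f by (meson inj_onD)
      qed
      then have "y = \<tau> (g \<circ> c)" by (rule ext)
      then show "y \<in> \<tau> ` (UNIV \<rightarrow> A)" using gc by (rule image_eqI)
    qed
  qed
qed

end

theory Submission
  imports Defs "HOL-Computational_Algebra.Polynomial" "HOL-Number_Theory.Cong"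
begin

text \<open>
  A matrix over \<open>K[M]\<close> with \<open>d\<close> rows and columns acts linearly on the configurations
  \<open>M \<rightarrow> K\<^sup>d\<close>, by a local rule, and this action determines the matrix. If \<open>K\<close> is finite, the action
  is a cellular automaton over a finite alphabet. Suppose \<open>\<alpha> \<beta> = 1\<close>. Then the automaton of \<open>\<alpha>\<close> has a
  left inverse, the automaton of \<open>\<beta>\<close>; so it is injective, hence surjective because \<open>M\<close> is
  surjunctive, and the left inverse is a right inverse too. This says \<open>\<beta> \<alpha> = 1\<close>.

  For infinite \<open>K\<close> the argument is run modulo an ideal. The entries of \<open>\<alpha>\<close> and \<open>\<beta>\<close> have finitely
  many coefficients, so they lie in some subring \<open>A\<close> of \<open>K\<close>, and for an ideal \<open>I\<close> of finite index in
  \<open>A\<close> the alphabet \<open>(A/I)\<^sup>d\<close> is finite. The argument with scalars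
  in \<open>A/I\<close> shows that the coefficients of \<open>\<beta> \<alpha> - 1\<close> lie in \<open>I\<close>
  (\<open>surjunctive_one_sided_inverse_mod\<close>). It remains to choose \<open>A\<close> and \<open>I\<close> so that a given
  nonzero coefficient \<open>r\<close> of \<open>\<beta> \<alpha> - 1\<close> is not in \<open>I\<close>.

  That this is possible amounts to the residual finiteness of finitely generated domains. It is
  proved by adjoining the generators one at a time to the image of the integers
  (\<open>finite_subset_finite_unit_quotients\<close>). The property carried along is stronger: every nonzero
  \<open>u\<close> in \<open>A\<close> becomes a unit in some nonzero finite quotient of \<open>A\<close>. Units are what the step from \<open>A\<close> to
  \<open>A[x]\<close> needs: a quotient of \<open>A\<close> in which the leading coefficient of a polynomial relation for \<open>x\<close>
  is a unit extends to a finite quotient of \<open>A[x]\<close>, whose elements are represented by polynomials of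
  bounded degree, and which is again nonzero (\<open>finite_quotient_adjoin\<close>).
\<close>


section \<open>Subrings of a domain and their finite quotients\<close>

locale coefficient_ring =
  fixes A :: "'a::idom set"
  assumes one_closed: "1 \<in> A"
    and diff_closed: "a \<in> A \<Longrightarrow> b \<in> A \<Longrightarrow> a - b \<in> A"
    and mult_closed: "a \<in> A \<Longrightarrow> b \<in> A \<Longrightarrow> a * b \<in> A"
begin

lemma zero_closed: "0 \<in> A"
  using diff_closed[OF one_closed one_closed] by simp

lemma uminus_closed: "a \<in> A \<Longrightarrow> - a \<in> A"
  using diff_closed[OF zero_closed, of a] by simp

lemma add_closed: "a \<in> A \<Longrightarrow> b \<in> A \<Longrightarrow> a + b \<in> A"
  using diff_closed[of a "- b"] uminus_closed[of b] by simp

lemma sum_closed: "(\<And>x. x \<in> X \<Longrightarrow> f x \<in> A) \<Longrightarrow> sum f X \<in> A"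
  by (induction X rule: infinite_finite_induct) (auto intro: zero_closed add_closed)

lemma power_closed: "a \<in> A \<Longrightarrow> a ^ n \<in> A"
  by (induction n) (auto intro: one_closed mult_closed)

lemmas closed = zero_closed one_closed uminus_closed add_closed diff_closed mult_closed power_closed

end

text \<open>
  Finiteness of the quotient is expressed by a finite set of representatives, so that the
  elements of the quotient can be handled as elements of the ring itself.
\<close>

locale finite_quotient = coefficient_ring A for A :: "'a::idom set" +
  fixes I :: "'a set"
  assumes ideal_subset: "I \<subseteq> A"
    and ideal_zero: "0 \<in> I"
    and ideal_diff: "x \<in> I \<Longrightarrow> y \<in> I \<Longrightarrow> x - y \<in> I"
    and ideal_mult: "a \<in> A \<Longrightarrow> x \<in> I \<Longrightarrow> a * x \<in> I"
    and ideal_proper: "1 \<notin> I"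
    and finite_index: "\<exists>F. finite F \<and> F \<subseteq> A \<and> (\<forall>a\<in>A. \<exists>f\<in>F. a - f \<in> I)"
begin

lemma ideal_uminus: "x \<in> I \<Longrightarrow> - x \<in> I"
  using ideal_diff[OF ideal_zero, of x] by simp

lemma ideal_add: "x \<in> I \<Longrightarrow> y \<in> I \<Longrightarrow> x + y \<in> I"
  using ideal_diff[of x "- y"] ideal_uminus[of y] by simp

lemma ideal_mult_right: "x \<in> I \<Longrightarrow> a \<in> A \<Longrightarrow> x * a \<in> I"
  using ideal_mult[of a x] by (simp add: mult.commute)

lemma ideal_sum: "(\<And>x. x \<in> X \<Longrightarrow> f x \<in> I) \<Longrightarrow> sum f X \<in> I"
  by (induction X rule: infinite_finite_induct) (auto intro: ideal_zero ideal_add)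

lemma ideal_diff_trans: "x - y \<in> I \<Longrightarrow> y - z \<in> I \<Longrightarrow> x - z \<in> I"
  using ideal_add[of "x - y" "y - z"] by simp

lemma ideal_diff_sym: "x - y \<in> I \<Longrightarrow> y - x \<in> I"
  using ideal_uminus[of "x - y"] by simp

definition unit_mod :: "'a \<Rightarrow> bool" where
  "unit_mod u \<longleftrightarrow> (\<exists>v\<in>A. u * v - 1 \<in> I)"

lemma unit_mod_cancel:
  assumes "unit_mod u" "a \<in> A" "a * u \<in> I" shows "a \<in> I"
proof -
  obtain v where v: "v \<in> A" "u * v - 1 \<in> I" using assms(1) unit_mod_def by blast
  have "v * (a * u) - a * (u * v - 1) \<in> I"
    using v assms by (blast intro: ideal_diff ideal_mult)
  then show ?thesis by (simp add: algebra_simps)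
qed

lemma unit_mod_mult:
  assumes "u \<in> A" "v \<in> A" "unit_mod u" "unit_mod v" shows "unit_mod (u * v)"
proof -
  obtain u' v' where *: "u' \<in> A" "u * u' - 1 \<in> I" "v' \<in> A" "v * v' - 1 \<in> I"
    using assms unit_mod_def by blast
  have "(v * v') * (u * u' - 1) + (v * v' - 1) \<in> I"
    using * assms by (intro ideal_add ideal_mult mult_closed)
  then have "u * v * (u' * v') - 1 \<in> I" by (simp add: algebra_simps)
  then show ?thesis using * mult_closed unit_mod_def by blast
qed

lemma unit_mod_power: "u \<in> A \<Longrightarrow> unit_mod u \<Longrightarrow> unit_mod (u ^ k)"
proof (induction k)
  case 0
  then show ?case using one_closed ideal_zero by (auto simp: unit_mod_def intro: bexI[of _ 1])
next
  case (Suc k)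
  then show ?case by (simp add: unit_mod_mult power_closed)
qed

lemma unit_mod_notin: "unit_mod u \<Longrightarrow> u \<notin> I"
  using unit_mod_cancel[of u 1] ideal_proper one_closed by auto

end

section \<open>Polynomials with coefficients in a subring\<close>

definition polys_over :: "'a::comm_ring_1 set \<Rightarrow> 'a poly set" where
  "polys_over S = {p. \<forall>i. coeff p i \<in> S}"

lemma coeff_polys_over: "p \<in> polys_over S \<Longrightarrow> coeff p i \<in> S"
  by (simp add: polys_over_def)

context coefficient_ring
begin

lemma polys_const: "a \<in> A \<Longrightarrow> [:a:] \<in> polys_over A"
  by (auto simp: polys_over_def coeff_pCons zero_closed split: nat.splits)

lemma polys_zero: "0 \<in> polys_over A"
  using zero_closed by (simp add: polys_over_def)

lemma polys_pCons: "a \<in> A \<Longrightarrow> p \<in> polys_over A \<Longrightarrow> pCons a p \<in> polys_over A"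
  by (auto simp: polys_over_def coeff_pCons split: nat.splits)

lemma polys_monom: "a \<in> A \<Longrightarrow> monom a n \<in> polys_over A"
  using zero_closed by (simp add: polys_over_def)

lemma polys_add: "p \<in> polys_over A \<Longrightarrow> q \<in> polys_over A \<Longrightarrow> p + q \<in> polys_over A"
  using add_closed by (simp add: polys_over_def)

lemma polys_diff: "p \<in> polys_over A \<Longrightarrow> q \<in> polys_over A \<Longrightarrow> p - q \<in> polys_over A"
  using diff_closed by (simp add: polys_over_def)

lemma polys_mult: "p \<in> polys_over A \<Longrightarrow> q \<in> polys_over A \<Longrightarrow> p * q \<in> polys_over A"
  by (auto simp: polys_over_def coeff_mult intro!: sum_closed mult_closed)

lemma polys_smult: "a \<in> A \<Longrightarrow> p \<in> polys_over A \<Longrightarrow> smult a p \<in> polys_over A"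
  using mult_closed by (simp add: polys_over_def)

lemmas polys = polys_const polys_zero polys_pCons polys_monom polys_add polys_diff polys_mult polys_smult

text \<open>
  Division with remainder inside \<open>A[X]\<close>: since the leading coefficient of the divisor need not
  be invertible in \<open>A\<close>, the dividend is first multiplied by a power of it.
\<close>

lemma pseudo_division:
  assumes "f \<in> polys_over A" "g \<in> polys_over A"
  obtains k w r where "smult (lead_coeff g ^ k) f = w * g + r"
    "w \<in> polys_over A" "r \<in> polys_over A" "r \<noteq> 0 \<Longrightarrow> degree r < degree g"
proof -
  have "\<exists>k w r. smult (lead_coeff g ^ k) f = w * g + r \<and>
      w \<in> polys_over A \<and> r \<in> polys_over A \<and> (\<forall>i\<ge>degree g. coeff r i = 0)"
    if "f \<in> polys_over A" "\<forall>i\<ge>n. coeff f i = 0" for n f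
    using that
  proof (induction n arbitrary: f)
    case 0
    then have "\<forall>i\<ge>degree g. coeff f i = 0" by simp
    then show ?case using 0 polys_zero by (intro exI[of _ 0] exI[of _ f]) simp
  next
    case (Suc n)
    show ?case
    proof (cases "degree g \<le> n")
      case False
      then have "\<forall>i\<ge>degree g. coeff f i = 0" using Suc.prems by simp
      then show ?thesis using Suc.prems polys_zero by (intro exI[of _ 0] exI[of _ f]) simp
    next
      case True
      define t where "t = monom (coeff f n) (n - degree g)"
      define f' where "f' = smult (lead_coeff g) f - t * g"
      have t: "t \<in> polys_over A" unfolding t_def
        using Suc.prems coeff_polys_over polys_monom by blast
      have f': "f' \<in> polys_over A" unfolding f'_def
        using Suc.prems assms coeff_polys_over t by (intro polys) auto
      have "coeff f' i = 0" if "i \<ge> n" for i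
      proof (cases "i = n")
        case True
        then show ?thesis using \<open>degree g \<le> n\<close> by (simp add: f'_def t_def coeff_monom_mult)
      next
        case False
        then have "coeff f i = 0" "coeff g (i - (n - degree g)) = 0"
          using that Suc.prems \<open>degree g \<le> n\<close> by (auto intro!: coeff_eq_0)
        then show ?thesis by (simp add: f'_def t_def coeff_monom_mult)
      qed
      then obtain k w r where kwr: "smult (lead_coeff g ^ k) f' = w * g + r"
        "w \<in> polys_over A" "r \<in> polys_over A" "\<forall>i\<ge>degree g. coeff r i = 0"
        using Suc.IH[OF f'] by blast
      have "smult (lead_coeff g ^ Suc k) f = (w + smult (lead_coeff g ^ k) t) * g + r"
        using kwr(1) by (simp add: f'_def smult_diff_right algebra_simps)
      moreover have "w + smult (lead_coeff g ^ k) t \<in> polys_over A"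
        using kwr t assms(2) by (intro polys closed) (auto intro: coeff_polys_over)
      ultimately show ?thesis using kwr by blast
    qed
  qed
  moreover have "\<forall>i\<ge>Suc (degree f). coeff f i = 0" by (simp add: coeff_eq_0)
  ultimately obtain k w r where *: "smult (lead_coeff g ^ k) f = w * g + r"
    "w \<in> polys_over A" "r \<in> polys_over A" "\<forall>i\<ge>degree g. coeff r i = 0"
    using assms by blast
  moreover have "degree r < degree g" if "r \<noteq> 0"
    using that *(4) by (metis leading_coeff_0_iff not_le)
  ultimately show thesis using that by blast
qed

definition adjoin :: "'a \<Rightarrow> 'a set" where
  "adjoin x = (\<lambda>p. poly p x) ` polys_over A"

lemma adjoinI: "p \<in> polys_over A \<Longrightarrow> poly p x \<in> adjoin x"
  by (simp add: adjoin_def)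

lemma adjoinE:
  assumes "a \<in> adjoin x" obtains p where "p \<in> polys_over A" "a = poly p x"
  using assms by (auto simp: adjoin_def)

lemma subset_adjoin: "A \<subseteq> adjoin x"
  using polys_const adjoinI[of "[:_:]" x] by fastforce

lemma generator_in_adjoin: "x \<in> adjoin x"
  using adjoinI[of "[:0, 1:]" x] by (simp add: polys closed)

lemma coefficient_ring_adjoin: "coefficient_ring (adjoin x)"
proof
  show "1 \<in> adjoin x" using one_closed subset_adjoin by blast
next
  fix a b assume "a \<in> adjoin x" "b \<in> adjoin x"
  then obtain p q where p: "p \<in> polys_over A" "a = poly p x"
    and q: "q \<in> polys_over A" "b = poly q x"
    by (elim adjoinE)
  show "a - b \<in> adjoin x" using adjoinI[of "p - q" x] p q by (simp add: polys)
  show "a * b \<in> adjoin x" using adjoinI[of "p * q" x] p q by (simp add: polys)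
qed

text \<open>
  The remainder of \<open>f\<close> vanishes at \<open>x\<close> as well, and its degree is too small for it to be nonzero.
\<close>

lemma minimal_polynomial_divides:
  assumes g: "g \<in> polys_over A" "g \<noteq> 0" "poly g x = 0"
    and min: "\<And>f. f \<in> polys_over A \<Longrightarrow> f \<noteq> 0 \<Longrightarrow> poly f x = 0 \<Longrightarrow> degree g \<le> degree f"
    and f: "f \<in> polys_over A" "poly f x = 0"
  shows "\<exists>k. \<exists>w\<in>polys_over A. smult (lead_coeff g ^ k) f = w * g"
proof -
  obtain k w r where *: "smult (lead_coeff g ^ k) f = w * g + r"
    "w \<in> polys_over A" "r \<in> polys_over A" "r \<noteq> 0 \<Longrightarrow> degree r < degree g"
    using pseudo_division[OF f(1) g(1)] by blast
  have "poly r x = 0" using arg_cong[OF *(1), of "\<lambda>p. poly p x"] f g by simp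
  then have "r = 0" using min *(3,4) by fastforce
  then show ?thesis using * by auto
qed

text \<open>
  This is how an element of \<open>A[x]\<close> can be made a unit by means of an element of \<open>A\<close>. It is the Euclidean algorithm for \<open>g\<close> and \<open>q\<close> without denominators: a
  division of \<open>g\<close> by \<open>q\<close> leaves a remainder that is, at \<open>x\<close>, a multiple of \<open>q\<close>, and minimality of
  \<open>g\<close> keeps that remainder from vanishing at \<open>x\<close>.
\<close>

lemma adjoin_algebraic_divides_constant:
  assumes g: "g \<in> polys_over A" "g \<noteq> 0" "poly g x = 0"
    and min: "\<And>f. f \<in> polys_over A \<Longrightarrow> f \<noteq> 0 \<Longrightarrow> poly f x = 0 \<Longrightarrow> degree g \<le> degree f"
    and q: "q \<in> polys_over A" "poly q x \<noteq> 0"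
  shows "\<exists>s\<in>polys_over A. \<exists>c\<in>A. c \<noteq> 0 \<and> poly s x * poly q x = c"
  using q
proof (induction "degree q" arbitrary: q rule: less_induct)
  case less
  consider "degree q = 0" | "degree g \<le> degree q" "degree q > 0" | "0 < degree q" "degree q < degree g"
    by linarith
  then show ?case
  proof cases
    case 1
    then obtain c where c: "q = [:c:]" using degree_eq_zeroE by blast
    then have "c \<in> A" using less.prems coeff_polys_over[of q A 0] by simp
    then show ?thesis using c less.prems one_closed
      by (intro bexI[of _ 1] bexI[of _ c]) (auto simp: one_pCons polys)
  next
    case 2
    obtain k w r where *: "smult (lead_coeff g ^ k) q = w * g + r"
      "w \<in> polys_over A" "r \<in> polys_over A" "r \<noteq> 0 \<Longrightarrow> degree r < degree g"
      using pseudo_division[OF less.prems(1) g(1)] by blast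
    have rx: "poly r x = lead_coeff g ^ k * poly q x"
      using arg_cong[OF *(1), of "\<lambda>p. poly p x"] g by simp
    then have "poly r x \<noteq> 0" using g less.prems by simp
    moreover from this have "degree r < degree q" using 2 *(4) by force
    ultimately obtain s c where s: "s \<in> polys_over A" "c \<in> A" "c \<noteq> 0" "poly s x * poly r x = c"
      using less.hyps[of r] * by blast
    have "smult (lead_coeff g ^ k) s \<in> polys_over A"
      using s g by (intro polys closed) (auto intro: coeff_polys_over)
    moreover have "poly (smult (lead_coeff g ^ k) s) x * poly q x = c"
      using s rx by (simp add: algebra_simps)
    ultimately show ?thesis using s by blast
  next
    case 3
    obtain k w r where *: "smult (lead_coeff q ^ k) g = w * q + r"
      "w \<in> polys_over A" "r \<in> polys_over A" "r \<noteq> 0 \<Longrightarrow> degree r < degree q"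
      using pseudo_division[OF g(1) less.prems(1)] by blast
    have rx: "poly r x = - (poly w x * poly q x)"
      using arg_cong[OF *(1), of "\<lambda>p. poly p x"] g by (simp add: add_eq_0_iff)
    have "poly r x \<noteq> 0"
    proof
      assume "poly r x = 0"
      then have wx: "poly w x = 0" using rx less.prems by simp
      have "r = 0" using min[OF *(3)] \<open>poly r x = 0\<close> *(4) 3 by fastforce
      then have eq: "smult (lead_coeff q ^ k) g = w * q" using * by simp
      have "q \<noteq> 0" using 3 by auto
      then have "w \<noteq> 0" using eq g by auto
      then have "degree g = degree w + degree q"
        using arg_cong[OF eq, of degree] \<open>q \<noteq> 0\<close> by (simp add: degree_mult_eq)
      then show False using min[OF *(2) \<open>w \<noteq> 0\<close> wx] 3 by simp
    qed
    moreover from this have "degree r < degree q" using *(4) by force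
    ultimately obtain s c where s: "s \<in> polys_over A" "c \<in> A" "c \<noteq> 0" "poly s x * poly r x = c"
      using less.hyps[of r] * by blast
    have "poly (0 - s * w) x * poly q x = c" using s rx by (simp add: algebra_simps)
    moreover have "0 - s * w \<in> polys_over A" using s * by (intro polys)
    ultimately show ?thesis using s by blast
  qed
qed

end


section \<open>Extending a finite quotient to one more generator\<close>

context finite_quotient
begin

lemma polys_ideal_subset: "polys_over I \<subseteq> polys_over A"
  using ideal_subset by (auto simp: polys_over_def)

lemma polys_ideal_mult: "p \<in> polys_over A \<Longrightarrow> q \<in> polys_over I \<Longrightarrow> p * q \<in> polys_over I"
  by (auto simp: polys_over_def coeff_mult intro!: ideal_sum ideal_mult)

lemma polys_ideal_diff: "p \<in> polys_over I \<Longrightarrow> q \<in> polys_over I \<Longrightarrow> p - q \<in> polys_over I"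
  using ideal_diff by (simp add: polys_over_def)

lemma polys_ideal_const: "a \<in> I \<Longrightarrow> [:a:] \<in> polys_over I"
  by (auto simp: polys_over_def coeff_pCons ideal_zero split: nat.splits)

text \<open>
  Modulo \<open>I\<close> the leading coefficient of \<open>g\<close> is a unit, so there the degree of a multiple of \<open>g\<close> is at
  least that of \<open>g\<close>, unless the multiple is zero. The coefficients of \<open>w\<close> are seen to lie in \<open>I\<close>
  from the top one downwards.
\<close>

lemma constant_multiple_trivial:
  assumes w: "w \<in> polys_over A" and g: "g \<in> polys_over A" "degree g > 0"
    and unit: "unit_mod (lead_coeff g)"
    and c: "w * g - [:c:] \<in> polys_over I"
  shows "c \<in> I"
proof -
  have step: "coeff w n \<in> I" if above: "\<And>i. i > n \<Longrightarrow> coeff w i \<in> I" for n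
  proof -
    let ?N = "n + degree g"
    have "coeff (w * g) ?N \<in> I"
      using coeff_polys_over[OF c, of ?N] g by (simp add: coeff_pCons split: nat.splits)
    moreover have "coeff (w * g) ?N = coeff w n * lead_coeff g
        + (\<Sum>i\<in>{..?N} - {n}. coeff w i * coeff g (?N - i))"
      by (simp add: coeff_mult sum.remove[of "{..?N}" n])
    moreover have "(\<Sum>i\<in>{..?N} - {n}. coeff w i * coeff g (?N - i)) \<in> I"
    proof (rule ideal_sum)
      fix i assume i: "i \<in> {..?N} - {n}"
      show "coeff w i * coeff g (?N - i) \<in> I"
      proof (cases "i < n")
        case True
        then have "coeff g (?N - i) = 0" by (intro coeff_eq_0) simp
        then show ?thesis using ideal_zero by simp
      next
        case False
        then show ?thesis using i above coeff_polys_over[OF g(1)] by (intro ideal_mult_right) auto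
      qed
    qed
    ultimately have "coeff w n * lead_coeff g \<in> I" using ideal_diff by fastforce
    then show ?thesis using unit_mod_cancel[OF unit] coeff_polys_over[OF w] by blast
  qed
  have "coeff w i \<in> I" if "i + n > degree w" for n i
    using that
  proof (induction n arbitrary: i)
    case 0
    then show ?case using ideal_zero by (simp add: coeff_eq_0)
  next
    case (Suc n)
    show ?case by (rule step, rule Suc.IH) (use Suc.prems in simp)
  qed
  then have "coeff w 0 \<in> I" by (metis add_0 lessI)
  then have "coeff w 0 * coeff g 0 \<in> I" using coeff_polys_over[OF g(1)] by (intro ideal_mult_right)
  moreover have "coeff w 0 * coeff g 0 - c \<in> I"
    using coeff_polys_over[OF c, of 0] by (simp add: coeff_mult)
  ultimately show "c \<in> I" using ideal_diff by fastforce
qed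

text \<open>
  Modulo \<open>I\<close> the power of the leading coefficient that pseudo-division introduces can be cancelled.
\<close>

lemma division_mod_ideal:
  assumes f: "f \<in> polys_over A" and g: "g \<in> polys_over A" "unit_mod (lead_coeff g)"
  obtains h w r where "h \<in> polys_over I" "w \<in> polys_over A" "r \<in> polys_over A"
    "f = h + w * g + r" "r \<noteq> 0 \<Longrightarrow> degree r < degree g"
proof -
  obtain k w r where *: "smult (lead_coeff g ^ k) f = w * g + r"
    "w \<in> polys_over A" "r \<in> polys_over A" "r \<noteq> 0 \<Longrightarrow> degree r < degree g"
    using pseudo_division[OF f g(1)] by blast
  obtain v where v: "v \<in> A" "lead_coeff g ^ k * v - 1 \<in> I"
    using unit_mod_power g coeff_polys_over unfolding unit_mod_def by blast
  let ?h = "smult (1 - lead_coeff g ^ k * v) f"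
  have "?h \<in> polys_over I"
    using ideal_diff_sym[OF v(2)] coeff_polys_over[OF f]
    by (auto simp: polys_over_def intro: ideal_mult_right)
  moreover have "smult v w \<in> polys_over A" "smult v r \<in> polys_over A"
    using v * by (auto intro: polys)
  moreover have "f = ?h + smult v w * g + smult v r"
  proof -
    have "smult v w * g + smult v r = smult v (smult (lead_coeff g ^ k) f)"
      by (simp add: * smult_add_right)
    then show ?thesis by (simp add: smult_diff_left add.assoc mult.commute)
  qed
  moreover have "smult v r \<noteq> 0 \<Longrightarrow> degree (smult v r) < degree g" using *(4) by auto
  ultimately show thesis using that by blast
qed

text \<open>The ideal of \<open>A[x]\<close> generated by \<open>I\<close> and \<open>g(x)\<close>.\<close>

definition adjoin_ideal :: "'a poly \<Rightarrow> 'a \<Rightarrow> 'a set" where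
  "adjoin_ideal g x = {poly (h + w * g) x | h w. h \<in> polys_over I \<and> w \<in> polys_over A}"

lemma adjoin_idealI:
  "h \<in> polys_over I \<Longrightarrow> w \<in> polys_over A \<Longrightarrow> poly h x + poly w x * poly g x \<in> adjoin_ideal g x"
  unfolding adjoin_ideal_def by force

lemma adjoin_idealE:
  assumes "a \<in> adjoin_ideal g x"
  obtains h w where "h \<in> polys_over I" "w \<in> polys_over A" "a = poly h x + poly w x * poly g x"
  using assms unfolding adjoin_ideal_def by force

lemma polys_ideal_zero: "0 \<in> polys_over I"
  using ideal_zero by (simp add: polys_over_def)

lemma subset_adjoin_ideal: "I \<subseteq> adjoin_ideal g x"
proof
  fix a assume "a \<in> I"
  then show "a \<in> adjoin_ideal g x"
    using adjoin_idealI[OF polys_ideal_const polys_zero, of a x g] by simp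
qed

lemma value_in_adjoin_ideal: "poly g x \<in> adjoin_ideal g x"
  using adjoin_idealI[OF polys_ideal_zero polys_const[OF one_closed], of x g] by simp

text \<open>
  The quotient of \<open>A[x]\<close> by \<open>I\<close> and \<open>g(x)\<close> is finite because every element has a representative of
  degree less than that of \<open>g\<close>. The point is that it is not the zero ring: the last assumption says
  that the relations between the powers of \<open>x\<close> follow from \<open>g\<close> up to a power of its leading
  coefficient, which is a unit modulo \<open>I\<close>; so a relation \<open>1 = h(x) + w(x) g(x)\<close> would make this
  power a multiple of \<open>g\<close> modulo \<open>I\<close>. The assumption holds in both cases of interest, for \<open>x\<close>
  transcendental and for \<open>g\<close> a minimal polynomial of \<open>x\<close>.
\<close>

lemma finite_quotient_adjoin:
  assumes g: "g \<in> polys_over A" "degree g > 0" "unit_mod (lead_coeff g)"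
    and rel: "\<And>f. f \<in> polys_over A \<Longrightarrow> poly f x = 0 \<Longrightarrow>
      \<exists>k. \<exists>w\<in>polys_over A. smult (lead_coeff g ^ k) f = w * g"
  shows "finite_quotient (adjoin x) (adjoin_ideal g x)"
proof -
  interpret B: coefficient_ring "adjoin x" by (rule coefficient_ring_adjoin)
  let ?J = "adjoin_ideal g x"
  show ?thesis
  proof
    show "?J \<subseteq> adjoin x"
    proof
      fix a assume "a \<in> ?J"
      then obtain h w where *: "h \<in> polys_over I" "w \<in> polys_over A"
        "a = poly h x + poly w x * poly g x" by (rule adjoin_idealE)
      then have "h + w * g \<in> polys_over A" using polys_ideal_subset g by (intro polys) auto
      from adjoinI[OF this, of x] show "a \<in> adjoin x" using * by simp
    qed
    show "0 \<in> ?J" using ideal_zero subset_adjoin_ideal by blast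
  next
    fix a b assume "a \<in> ?J" "b \<in> ?J"
    then obtain h w h' w' where *: "h \<in> polys_over I" "w \<in> polys_over A"
        "a = poly h x + poly w x * poly g x" "h' \<in> polys_over I" "w' \<in> polys_over A"
        "b = poly h' x + poly w' x * poly g x" by (elim adjoin_idealE)
    have "a - b = poly (h - h') x + poly (w - w') x * poly g x"
      using * by (simp add: algebra_simps)
    then show "a - b \<in> ?J"
      using adjoin_idealI[OF polys_ideal_diff polys_diff] * by metis
  next
    fix a b assume "a \<in> adjoin x" "b \<in> ?J"
    then obtain p h w where *: "p \<in> polys_over A" "a = poly p x" "h \<in> polys_over I"
      "w \<in> polys_over A" "b = poly h x + poly w x * poly g x" by (elim adjoin_idealE adjoinE)
    have "a * b = poly (p * h) x + poly (p * w) x * poly g x"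
      using * by (simp add: algebra_simps)
    then show "a * b \<in> ?J"
      using adjoin_idealI[OF polys_ideal_mult polys_mult] * by metis
  next
    show "1 \<notin> ?J"
    proof
      assume "1 \<in> ?J"
      then obtain h w where hw: "h \<in> polys_over I" "w \<in> polys_over A"
        "1 = poly h x + poly w x * poly g x" by (rule adjoin_idealE)
      let ?f = "[:1:] - h - w * g"
      have hA: "h \<in> polys_over A" using hw polys_ideal_subset by blast
      have "?f \<in> polys_over A" using hw hA g by (intro polys closed)
      moreover have "poly ?f x = 0" using hw(3) by (simp add: algebra_simps)
      ultimately obtain k w' where w': "w' \<in> polys_over A" "smult (lead_coeff g ^ k) ?f = w' * g"
        using rel by blast
      define b where "b = lead_coeff g ^ k"
      have b: "b \<in> A" "unit_mod b"
        unfolding b_def using g coeff_polys_over by (auto intro: power_closed unit_mod_power)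
      have "(w' + smult b w) * g - [:b:] = [:- b:] * h"
        using w'(2) unfolding b_def[symmetric]
        by (simp add: smult_diff_right smult_add_right algebra_simps)
      moreover have "[:- b:] * h \<in> polys_over I"
        using b hw by (intro polys_ideal_mult polys closed)
      moreover have "w' + smult b w \<in> polys_over A" using w' hw b by (intro polys)
      ultimately have "b \<in> I" using constant_multiple_trivial g by metis
      then show False using b unit_mod_notin by blast
    qed
  next
    obtain F where F: "finite F" "F \<subseteq> A" "\<forall>a\<in>A. \<exists>f\<in>F. a - f \<in> I" using finite_index by blast
    then obtain \<phi> where \<phi>: "\<And>a. a \<in> A \<Longrightarrow> \<phi> a \<in> F" "\<And>a. a \<in> A \<Longrightarrow> a - \<phi> a \<in> I" by metis
    define n where "n = degree g"
    define G where "G = (\<lambda>c. \<Sum>i<n. c i * x ^ i) ` ({..<n} \<rightarrow>\<^sub>E F)"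
    show "\<exists>G. finite G \<and> G \<subseteq> adjoin x \<and> (\<forall>a\<in>adjoin x. \<exists>f\<in>G. a - f \<in> ?J)"
    proof (intro exI[of _ G] conjI ballI)
      show "finite G" unfolding G_def using F by (intro finite_imageI finite_PiE) auto
      show "G \<subseteq> adjoin x"
        unfolding G_def using F subset_adjoin generator_in_adjoin
        by (force intro!: B.sum_closed B.mult_closed B.power_closed)
      fix a assume "a \<in> adjoin x"
      then obtain f where f: "f \<in> polys_over A" "a = poly f x" by (rule adjoinE)
      obtain h w r where *: "h \<in> polys_over I" "w \<in> polys_over A" "r \<in> polys_over A"
        "f = h + w * g + r" "r \<noteq> 0 \<Longrightarrow> degree r < degree g"
        using division_mod_ideal[OF f(1) g(1,3)] by blast
      have rn: "coeff r i = 0" if "i \<ge> n" for i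
        using *(5) that by (cases "r = 0") (auto simp: n_def intro: coeff_eq_0)
      define c where "c = restrict (\<lambda>i. \<phi> (coeff r i)) {..<n}"
      define r' where "r' = (\<Sum>i<n. monom (c i) i)"
      have c: "c \<in> {..<n} \<rightarrow>\<^sub>E F" using \<phi> coeff_polys_over[OF *(3)] by (auto simp: c_def)
      have "coeff r' i = (if i < n then c i else 0)" for i
        by (simp add: r'_def coeff_sum)
      then have "r - r' \<in> polys_over I"
        using \<phi> coeff_polys_over[OF *(3)] rn ideal_zero by (auto simp: polys_over_def c_def)
      moreover have "h - (0 - (r - r')) = h + (r - r')" by simp
      ultimately have "h + (r - r') \<in> polys_over I"
        using * polys_ideal_diff polys_ideal_zero by metis
      from adjoin_idealI[OF this *(2), of x g] have "a - poly r' x \<in> ?J"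
        using f * by (simp add: algebra_simps)
      moreover have "poly r' x \<in> G"
        unfolding G_def r'_def using c by (auto simp: poly_sum poly_monom)
      ultimately show "\<exists>f\<in>G. a - f \<in> ?J" by blast
    qed
  qed
qed

end

section \<open>Finitely generated domains have many finite quotients\<close>

text \<open>
  Keeping \<open>u\<close> out of the ideal would suffice in the end, but when a generator is adjoined the
  leading coefficient of a polynomial relation has to be inverted.
\<close>

definition finite_unit_quotients :: "'a::idom set \<Rightarrow> bool" where
  "finite_unit_quotients A \<longleftrightarrow> coefficient_ring A \<and>
     (\<forall>u\<in>A. u \<noteq> 0 \<longrightarrow> (\<exists>I. finite_quotient A I \<and> finite_quotient.unit_mod A I u))"

text \<open>
  In characteristic zero, \<open>n \<noteq> 0\<close> is a unit modulo any prime larger than \<open>\<bar>n\<bar>\<close>. In positive characteristic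
  \<open>p\<close> the image of the integers is already a finite field, and the ideal of the multiples of \<open>p\<close> is
  zero; so both cases use the multiples of a suitable prime.
\<close>

lemma finite_unit_quotients_integers: "finite_unit_quotients (range of_int :: 'a::idom set)"
  unfolding finite_unit_quotients_def
proof (intro conjI ballI impI)
  let ?Z = "range of_int :: 'a set"
  show Z: "coefficient_ring ?Z"
    unfolding Ints_def[symmetric] by standard auto
  fix u :: 'a assume u: "u \<in> ?Z" "u \<noteq> 0"
  from u(1) obtain n where n: "u = of_int n" by (rule rangeE)
  have "\<exists>p::int. prime p \<and> \<not> p dvd n \<and> (of_int p = (0::'a) \<or> CHAR('a) = 0)"
  proof (cases "CHAR('a) = 0")
    case True
    obtain q where q: "prime q" "q > nat \<bar>n\<bar>" using bigger_prime by blast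
    moreover have "n \<noteq> 0" using u n by auto
    then have "\<not> int q dvd n" using q zdvd_imp_le[of "int q" "\<bar>n\<bar>"] by auto
    ultimately show ?thesis using True by (intro exI[of _ "int q"]) simp
  next
    case False
    then have "prime CHAR('a)" using prime_CHAR_semidom by blast
    moreover have "\<not> int CHAR('a) dvd n" using u n of_int_eq_0_iff_char_dvd[where 'a='a, of n] by simp
    ultimately show ?thesis by (intro exI[of _ "int CHAR('a)"]) simp
  qed
  then obtain p :: int where p: "prime p" "\<not> p dvd n" "of_int p = (0::'a) \<or> CHAR('a) = 0"
    by (elim exE conjE)
  define I where "I = range (\<lambda>k. of_int (p * k) :: 'a)"
  have I: "of_int (p * k) \<in> I" for k unfolding I_def by (rule rangeI)
  interpret coefficient_ring ?Z by fact
  interpret finite_quotient ?Z I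
  proof
    show "I \<subseteq> ?Z" unfolding I_def by (intro image_subsetI rangeI)
    show "0 \<in> I" using I[of 0] by simp
    show "x - y \<in> I" if xy: "x \<in> I" "y \<in> I" for x y
    proof -
      obtain k l where "x = of_int (p * k)" "y = of_int (p * l)" using xy unfolding I_def by (elim rangeE)
      then show ?thesis using I[of "k - l"] by (simp add: algebra_simps)
    qed
    show "a * x \<in> I" if ax: "a \<in> ?Z" "x \<in> I" for a x
    proof -
      obtain k l where "a = of_int k" "x = of_int (p * l)" using ax unfolding I_def by (elim rangeE)
      then show ?thesis using I[of "k * l"] by (simp add: algebra_simps)
    qed
    show "1 \<notin> I"
    proof
      assume "1 \<in> I"
      then obtain k where k: "(1::'a) = of_int (p * k)" unfolding I_def by (rule rangeE)
      then have "of_int p \<noteq> (0::'a)" by auto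
      then have "CHAR('a) = 0" using p by simp
      moreover have "of_int (1 - p * k) = (0::'a)" using k by simp
      ultimately have "p * k = 1" using of_int_eq_0_iff_char_dvd[where 'a='a, of "1 - p * k"] by simp
      then show False using p(1) by (metis dvd_triv_left not_prime_unit)
    qed
    have "\<exists>f\<in>of_int ` {0..<p}. a - f \<in> I" if a: "a \<in> ?Z" for a
    proof -
      obtain m where m: "a = of_int m" using a by (rule rangeE)
      have "a - of_int (m mod p) = of_int (p * (m div p))"
        unfolding m of_int_diff[symmetric] by (simp add: minus_mod_eq_mult_div)
      moreover have "m mod p \<in> {0..<p}" using prime_gt_0_int[OF p(1)] by simp
      ultimately show ?thesis using I by (metis imageI)
    qed
    then show "\<exists>F. finite F \<and> F \<subseteq> ?Z \<and> (\<forall>a\<in>?Z. \<exists>f\<in>F. a - f \<in> I)"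
      by (intro exI[of _ "of_int ` {0..<p}"]) auto
  qed
  have "coprime n p" using prime_imp_coprime[OF p(1,2)] by (simp add: coprime_commute)
  from cong_solve_coprime_int[OF this] obtain a where "[n * a = 1] (mod p)" by (rule exE)
  then have "p dvd n * a - 1" by (simp add: cong_iff_dvd_diff)
  then obtain k where "n * a - 1 = p * k" by (rule dvdE)
  then have "u * of_int a - 1 = of_int (p * k)"
    unfolding n by (metis of_int_1 of_int_diff of_int_mult)
  then have "unit_mod u" unfolding unit_mod_def using I[of k] by (intro bexI[of _ "of_int a"]) simp_all
  then show "\<exists>I. finite_quotient ?Z I \<and> finite_quotient.unit_mod ?Z I u"
    using finite_quotient_axioms by blast
qed

text \<open>
  If \<open>x\<close> is transcendental over \<open>A\<close>, the relation \<open>x v = 1\<close> is imposed on \<open>A[x]\<close>, for \<open>v\<close> the element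
  that has to become a unit; its degree in \<open>x\<close> is positive even when \<open>v\<close> is constant. If \<open>x\<close> is algebraic, no relation is imposed beyond those already there,
  and \<open>v\<close> becomes a unit because it divides an element \<open>c\<close> of \<open>A\<close> that does.
\<close>

lemma finite_unit_quotients_adjoin:
  assumes "finite_unit_quotients A"
  shows "finite_unit_quotients (coefficient_ring.adjoin A x)"
proof -
  interpret coefficient_ring A using assms by (simp add: finite_unit_quotients_def)
  have quot: "\<exists>I. finite_quotient A I \<and> finite_quotient.unit_mod A I u" if "u \<in> A" "u \<noteq> 0" for u
    using assms that finite_unit_quotients_def by blast
  show ?thesis
    unfolding finite_unit_quotients_def
  proof (intro conjI ballI impI coefficient_ring_adjoin)
    fix v assume "v \<in> adjoin x" and v0: "v \<noteq> 0"
    then obtain q where q: "q \<in> polys_over A" "v = poly q x" by (elim adjoinE)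
    have q0: "q \<noteq> 0" using q v0 by auto
    show "\<exists>J. finite_quotient (adjoin x) J \<and> finite_quotient.unit_mod (adjoin x) J v"
    proof (cases "\<exists>f\<in>polys_over A. f \<noteq> 0 \<and> poly f x = 0")
      case False
      obtain I where I: "finite_quotient A I" "finite_quotient.unit_mod A I (lead_coeff q)"
        using quot[of "lead_coeff q"] q q0 coeff_polys_over by fastforce
      interpret I: finite_quotient A I by fact
      define g where "g = pCons (- 1) q"
      have g: "g \<in> polys_over A" "degree g > 0" "lead_coeff g = lead_coeff q"
        using q q0 by (auto simp: g_def intro!: polys closed)
      interpret J: finite_quotient "adjoin x" "I.adjoin_ideal g x"
      proof (rule I.finite_quotient_adjoin)
        fix f assume "f \<in> polys_over A" "poly f x = 0"
        then have "f = 0" using False by blast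
        then show "\<exists>k. \<exists>w\<in>polys_over A. smult (lead_coeff g ^ k) f = w * g"
          by (auto intro: bexI[of _ 0] polys)
      qed (use g I in auto)
      have "v * x - 1 \<in> I.adjoin_ideal g x"
        using I.value_in_adjoin_ideal[of g x] q by (simp add: g_def algebra_simps)
      then have "J.unit_mod v" using J.unit_mod_def generator_in_adjoin by blast
      then show ?thesis using J.finite_quotient_axioms by blast
    next
      case True
      define P where "P f \<longleftrightarrow> f \<in> polys_over A \<and> f \<noteq> 0 \<and> poly f x = 0" for f
      define g where "g = (ARG_MIN degree f. P f)"
      obtain f where "P f" using True unfolding P_def by blast
      then have "P g" unfolding g_def by (rule arg_min_natI)
      then have g: "g \<in> polys_over A" "g \<noteq> 0" "poly g x = 0" by (auto simp: P_def)
      have min: "degree g \<le> degree f" if "f \<in> polys_over A" "f \<noteq> 0" "poly f x = 0" for f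
        unfolding g_def by (rule arg_min_nat_le) (use that P_def in auto)
      have deg: "degree g > 0"
      proof (rule ccontr)
        assume "\<not> degree g > 0"
        then obtain c where "g = [:c:]" using degree_eq_zeroE by blast
        then show False using g by simp
      qed
      obtain s c where s: "s \<in> polys_over A" "c \<in> A" "c \<noteq> 0" "poly s x * v = c"
        using adjoin_algebraic_divides_constant[OF g min q(1)] q(2) v0 by blast
      define b where "b = lead_coeff g"
      have b: "b \<in> A" "b \<noteq> 0" using g coeff_polys_over by (auto simp: b_def)
      obtain I where I: "finite_quotient A I" "finite_quotient.unit_mod A I (c * b)"
        using quot[of "c * b"] b s mult_closed by fastforce
      interpret I: finite_quotient A I by fact
      obtain u where u: "u \<in> A" "c * b * u - 1 \<in> I" using I I.unit_mod_def by blast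
      interpret J: finite_quotient "adjoin x" "I.adjoin_ideal g x"
      proof (rule I.finite_quotient_adjoin[OF g(1) deg])
        show "I.unit_mod (lead_coeff g)" unfolding I.unit_mod_def b_def[symmetric]
          using u s mult_closed by (intro bexI[of _ "c * u"]) (auto simp: mult_ac)
        show "\<exists>k. \<exists>w\<in>polys_over A. smult (lead_coeff g ^ k) f = w * g"
          if "f \<in> polys_over A" "poly f x = 0" for f
          using minimal_polynomial_divides[OF g min that] by blast
      qed
      have "v * (poly s x * (b * u)) = c * b * u" using s(4) by (simp add: mult_ac)
      then have "v * (poly s x * (b * u)) - 1 \<in> I.adjoin_ideal g x"
        using subsetD[OF I.subset_adjoin_ideal u(2)] by metis
      moreover have "poly s x * (b * u) \<in> adjoin x"
        using s b u adjoinI subset_adjoin by (intro J.mult_closed) auto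
      ultimately have "J.unit_mod v" using J.unit_mod_def by blast
      then show ?thesis using J.finite_quotient_axioms by blast
    qed
  qed
qed

lemma finite_subset_finite_unit_quotients:
  assumes "finite (C :: 'a::idom set)"
  shows "\<exists>A. C \<subseteq> A \<and> finite_unit_quotients A"
  using assms
proof induction
  case empty
  then show ?case using finite_unit_quotients_integers by blast
next
  case (insert x C)
  then obtain A where A: "C \<subseteq> A" "finite_unit_quotients A" by (elim exE conjE)
  interpret coefficient_ring A using A(2) by (simp add: finite_unit_quotients_def)
  have "insert x C \<subseteq> adjoin x"
    using A(1) subset_adjoin generator_in_adjoin by (intro insert_subsetI subset_trans[OF A(1)])
  then show ?case using finite_unit_quotients_adjoin[OF A(2)] by (intro exI conjI)
qed

section \<open>Matrices over a monoid algebra as linear cellular automata\<close>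

text \<open>The linear extension of \<open>f\<close> to the monoid algebra.\<close>

definition linear_ext :: "('m \<Rightarrow>\<^sub>0 'k::comm_ring_1) \<Rightarrow> ('m \<Rightarrow> 'k) \<Rightarrow> 'k" where
  "linear_ext a f = (\<Sum>s\<in>Poly_Mapping.keys a. Poly_Mapping.lookup a s * f s)"

lemma linear_ext_superset:
  assumes "finite S" "Poly_Mapping.keys a \<subseteq> S"
  shows "linear_ext a f = (\<Sum>s\<in>S. Poly_Mapping.lookup a s * f s)"
  unfolding linear_ext_def using assms
  by (intro sum.mono_neutral_left) (auto simp: in_keys_iff)

lemma linear_ext_add: "linear_ext (a + b) f = linear_ext a f + linear_ext b f"
proof -
  let ?S = "Poly_Mapping.keys a \<union> Poly_Mapping.keys b"
  have "linear_ext x f = (\<Sum>s\<in>?S. Poly_Mapping.lookup x s * f s)" if "x \<in> {a, b, a + b}" for x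
    using that keys_add[of a b] by (intro linear_ext_superset) auto
  then show ?thesis by (simp add: lookup_add sum.distrib algebra_simps)
qed

lemma linear_ext_zero: "linear_ext 0 f = 0"
  by (simp add: linear_ext_def)

lemma linear_ext_sum: "linear_ext (sum a X) f = (\<Sum>x\<in>X. linear_ext (a x) f)"
  by (induction X rule: infinite_finite_induct) (simp_all add: linear_ext_zero linear_ext_add)

lemma linear_ext_single: "linear_ext (Poly_Mapping.single s k) f = k * f s"
  by (subst linear_ext_superset[of "{s}"]) auto

lemma linear_ext_one: "linear_ext 1 f = f 0"
  using linear_ext_single[of 0 1 f] by simp

lemma linear_ext_diff_right: "linear_ext a (\<lambda>s. f s - g s) = linear_ext a f - linear_ext a g"
  by (simp add: linear_ext_def algebra_simps sum_subtractf)

lemma linear_ext_sum_right: "linear_ext a (\<lambda>s. \<Sum>x\<in>X. f x s) = (\<Sum>x\<in>X. linear_ext a (f x))"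
  unfolding linear_ext_def sum_distrib_left by (rule sum.swap)

lemma linear_ext_swap:
  "linear_ext a (\<lambda>s. linear_ext b (\<lambda>t. f s t)) = linear_ext b (\<lambda>t. linear_ext a (\<lambda>s. f s t))"
  unfolding linear_ext_def sum_distrib_left
  by (subst sum.swap) (simp add: algebra_simps)

lemma linear_ext_mult:
  fixes a b :: "'m::monoid_add \<Rightarrow>\<^sub>0 'k::comm_ring_1"
  shows "linear_ext (a * b) f = linear_ext a (\<lambda>s. linear_ext b (\<lambda>t. f (s + t)))"
proof -
  have monomials: "x = (\<Sum>s\<in>Poly_Mapping.keys x. Poly_Mapping.single s (Poly_Mapping.lookup x s))"
    for x :: "'m \<Rightarrow>\<^sub>0 'k"
  proof (rule poly_mapping_eqI)
    fix t
    have "(\<Sum>s\<in>Poly_Mapping.keys x. Poly_Mapping.lookup (Poly_Mapping.single s (Poly_Mapping.lookup x s)) t)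
        = (\<Sum>s\<in>Poly_Mapping.keys x. if s = t then Poly_Mapping.lookup x s else 0)"
      by (intro sum.cong) (auto simp: lookup_single)
    then show "Poly_Mapping.lookup x t = Poly_Mapping.lookup
        (\<Sum>s\<in>Poly_Mapping.keys x. Poly_Mapping.single s (Poly_Mapping.lookup x s)) t"
      by (simp add: lookup_sum in_keys_iff)
  qed
  have "a * b = (\<Sum>s\<in>Poly_Mapping.keys a. \<Sum>t\<in>Poly_Mapping.keys b.
      Poly_Mapping.single (s + t) (Poly_Mapping.lookup a s * Poly_Mapping.lookup b t))"
    by (subst monomials[of a], subst monomials[of b]) (simp add: sum_product mult_single)
  then have "linear_ext (a * b) f = (\<Sum>s\<in>Poly_Mapping.keys a. \<Sum>t\<in>Poly_Mapping.keys b.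
      Poly_Mapping.lookup a s * Poly_Mapping.lookup b t * f (s + t))"
    by (simp add: linear_ext_sum linear_ext_single)
  then show ?thesis by (simp add: linear_ext_def sum_distrib_left mult.assoc)
qed

text \<open>
  A configuration assigns to each element of \<open>M\<close> a row vector \<open>c m\<close>, and a matrix acts on it from
  the right. Since \<open>c\<close> is shifted by right translations, the factors of \<open>K[M]\<close> are met in the
  opposite order, and so the action reverses products.
\<close>

definition act :: "nat \<Rightarrow> ('m::monoid_add \<Rightarrow>\<^sub>0 'k::comm_ring_1) mat \<Rightarrow> ('m \<Rightarrow> nat \<Rightarrow> 'k) \<Rightarrow> 'm \<Rightarrow> nat \<Rightarrow> 'k" where
  "act d \<alpha> c m j = (\<Sum>i<d. linear_ext (\<alpha> $$ (i, j)) (\<lambda>s. c (s + m) i))"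

lemma act_mult:
  assumes "\<alpha> \<in> carrier_mat d d" "\<beta> \<in> carrier_mat d d" "k < d"
  shows "act d (\<beta> * \<alpha>) c m k = act d \<alpha> (act d \<beta> c) m k"
proof -
  have "(\<beta> * \<alpha>) $$ (i, k) = (\<Sum>j<d. \<beta> $$ (i, j) * \<alpha> $$ (j, k))" if "i < d" for i
    using assms that by (auto simp: scalar_prod_def atLeast0LessThan intro!: sum.cong)
  then have "act d (\<beta> * \<alpha>) c m k = (\<Sum>i<d. \<Sum>j<d.
      linear_ext (\<beta> $$ (i, j)) (\<lambda>t. linear_ext (\<alpha> $$ (j, k)) (\<lambda>s. c (t + s + m) i)))"
    by (simp add: act_def linear_ext_sum linear_ext_mult)
  also have "\<dots> = (\<Sum>i<d. \<Sum>j<d.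
      linear_ext (\<alpha> $$ (j, k)) (\<lambda>s. linear_ext (\<beta> $$ (i, j)) (\<lambda>t. c (t + s + m) i)))"
    by (intro sum.cong refl linear_ext_swap)
  also have "\<dots> = act d \<alpha> (act d \<beta> c) m k"
    unfolding act_def by (subst sum.swap) (simp add: linear_ext_sum_right add.assoc)
  finally show ?thesis .
qed

lemma act_one: "j < d \<Longrightarrow> act d (1\<^sub>m d) c m j = c m j"
proof -
  assume j: "j < d"
  have "act d (1\<^sub>m d) c m j = (\<Sum>i<d. if i = j then c m i else 0)"
    unfolding act_def using j by (intro sum.cong) (auto simp: linear_ext_one linear_ext_zero)
  then show ?thesis using j by simp
qed

text \<open>This recovers a matrix from its action.\<close>

lemma act_delta:
  assumes "i < d"
  shows "act d \<alpha> (\<lambda>m i'. if m = s \<and> i' = i then 1 else 0) 0 j = Poly_Mapping.lookup (\<alpha> $$ (i, j)) s"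
proof -
  have *: "linear_ext a (\<lambda>t. if t = s \<and> i' = i then 1 else 0)
      = (if i' = i then Poly_Mapping.lookup a s else 0)" for a and i'
    by (subst linear_ext_superset[of "insert s (Poly_Mapping.keys a)"])
      (auto simp: if_distrib[of "(*) _"] cong: if_cong)
  show ?thesis using assms by (simp add: act_def *)
qed

section \<open>Surjunctivity modulo an ideal of finite index\<close>

context finite_quotient
begin

definition representatives :: "'a set" where
  "representatives = (SOME F. finite F \<and> F \<subseteq> A \<and> (\<forall>a\<in>A. \<exists>f\<in>F. a - f \<in> I))"

text \<open>
  The choice refers to \<open>a\<close> only through its class modulo \<open>I\<close>, so congruent elements have equal
  representatives.
\<close>

definition rep :: "'a \<Rightarrow> 'a" where
  "rep a = (SOME f. f \<in> representatives \<and> a - f \<in> I)"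

lemma representatives: "finite representatives" "representatives \<subseteq> A"
    "a \<in> A \<Longrightarrow> \<exists>f\<in>representatives. a - f \<in> I"
  unfolding representatives_def using someI_ex[OF finite_index] by blast+

lemma rep_in: "a \<in> A \<Longrightarrow> rep a \<in> representatives"
  and rep_diff: "a \<in> A \<Longrightarrow> a - rep a \<in> I"
  unfolding rep_def
  using someI_ex[of "\<lambda>f. f \<in> representatives \<and> a - f \<in> I"] representatives(3)[of a] by blast+

lemma rep_closed: "a \<in> A \<Longrightarrow> rep a \<in> A"
  using rep_in representatives(2) by blast

lemma rep_eqI:
  assumes "a - b \<in> I" shows "rep a = rep b"
proof -
  have "a - f \<in> I \<longleftrightarrow> b - f \<in> I" for f
    using assms ideal_diff_trans ideal_diff_sym by blast
  then show ?thesis by (simp add: rep_def)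
qed

lemma rep_eqD: "rep a = rep b \<Longrightarrow> a \<in> A \<Longrightarrow> b \<in> A \<Longrightarrow> a - b \<in> I"
  using rep_diff ideal_diff_trans ideal_diff_sym by metis

lemma rep_idem: "a \<in> A \<Longrightarrow> rep (rep a) = rep a"
  using rep_eqI rep_diff by metis

text \<open>A model of \<open>(A/I)\<^sup>d\<close>.\<close>

definition alphabet :: "nat \<Rightarrow> (nat \<Rightarrow> 'a) set" where
  "alphabet d = {..<d} \<rightarrow>\<^sub>E rep ` A"

lemma finite_alphabet: "finite (alphabet d)"
proof -
  have "rep ` A \<subseteq> representatives" using rep_in by blast
  then have "finite (rep ` A)" using representatives(1) finite_subset by blast
  then show ?thesis unfolding alphabet_def by (intro finite_PiE) auto
qed

lemma alphabet_closed: "x \<in> alphabet d \<Longrightarrow> i < d \<Longrightarrow> x i \<in> A"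
  using rep_closed by (force simp: alphabet_def PiE_iff)

lemma rep_alphabet: "x \<in> alphabet d \<Longrightarrow> i < d \<Longrightarrow> rep (x i) = x i"
  using rep_idem by (force simp: alphabet_def PiE_iff)

lemma alphabet_eqI:
  "x \<in> alphabet d \<Longrightarrow> y \<in> alphabet d \<Longrightarrow> (\<And>i. i < d \<Longrightarrow> x i = y i) \<Longrightarrow> x = y"
  unfolding alphabet_def by (rule PiE_ext) auto

definition coeffs_closed :: "nat \<Rightarrow> ('m \<Rightarrow>\<^sub>0 'a) mat \<Rightarrow> bool" where
  "coeffs_closed d \<alpha> \<longleftrightarrow> (\<forall>i<d. \<forall>j<d. \<forall>s. Poly_Mapping.lookup (\<alpha> $$ (i, j)) s \<in> A)"

lemma act_closed:
  assumes "coeffs_closed d \<alpha>" "j < d" "\<And>m i. i < d \<Longrightarrow> c m i \<in> A"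
  shows "act d \<alpha> c m j \<in> A"
  unfolding act_def linear_ext_def using assms
  by (intro sum_closed mult_closed) (auto simp: coeffs_closed_def)

lemma act_cong_mod:
  assumes "coeffs_closed d \<alpha>" "j < d" "\<And>m i. i < d \<Longrightarrow> c m i - c' m i \<in> I"
  shows "act d \<alpha> c m j - act d \<alpha> c' m j \<in> I"
proof -
  have "act d \<alpha> c m j - act d \<alpha> c' m j
      = (\<Sum>i<d. linear_ext (\<alpha> $$ (i, j)) (\<lambda>s. c (s + m) i - c' (s + m) i))"
    by (simp add: act_def linear_ext_diff_right sum_subtractf)
  also have "\<dots> \<in> I"
    unfolding linear_ext_def using assms
    by (intro ideal_sum ideal_mult) (auto simp: coeffs_closed_def)
  finally show ?thesis .
qed

definition act_mod :: "nat \<Rightarrow> ('m::monoid_add \<Rightarrow>\<^sub>0 'a) mat \<Rightarrow> ('m \<Rightarrow> nat \<Rightarrow> 'a) \<Rightarrow> 'm \<Rightarrow> nat \<Rightarrow> 'a" where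
  "act_mod d \<alpha> c m = (\<lambda>j\<in>{..<d}. rep (act d \<alpha> c m j))"

lemma act_mod_alphabet:
  assumes "coeffs_closed d \<alpha>" "\<And>m. c m \<in> alphabet d"
  shows "act_mod d \<alpha> c m \<in> alphabet d"
  using act_closed[OF assms(1)] alphabet_closed[OF assms(2)]
  by (auto simp: act_mod_def alphabet_def)

lemma act_mod_diff:
  assumes "coeffs_closed d \<alpha>" "\<And>m. c m \<in> alphabet d" "j < d"
  shows "act_mod d \<alpha> c m j - act d \<alpha> c m j \<in> I"
  using rep_diff[OF act_closed[OF assms(1,3)], of c m] alphabet_closed[OF assms(2)] assms(3)
  by (auto simp: act_mod_def intro: ideal_diff_sym)

lemma act_mod_act_mod:
  fixes \<alpha> \<beta> :: "('m::monoid_add \<Rightarrow>\<^sub>0 'a) mat"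
  assumes \<alpha>: "\<alpha> \<in> carrier_mat d d" "coeffs_closed d \<alpha>"
    and \<beta>: "\<beta> \<in> carrier_mat d d" "coeffs_closed d \<beta>"
    and c: "\<And>m. c m \<in> alphabet d" and j: "j < d"
  shows "act_mod d \<alpha> (act_mod d \<beta> c) m j = rep (act d (\<beta> * \<alpha>) c m j)"
proof -
  have "act d \<alpha> (act_mod d \<beta> c) m j - act d \<alpha> (act d \<beta> c) m j \<in> I"
    using act_mod_diff[OF \<beta>(2) c] by (intro act_cong_mod \<alpha> j) auto
  then show ?thesis using j act_mult[OF \<alpha>(1) \<beta>(1) j, of c m]
    by (simp add: act_mod_def rep_eqI)
qed

lemma cellular_automaton_act_mod:
  fixes \<alpha> :: "('m::monoid_add \<Rightarrow>\<^sub>0 'a) mat"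
  assumes \<alpha>: "coeffs_closed d \<alpha>"
  shows "cellular_automaton (alphabet d) (act_mod d \<alpha>)"
proof -
  define S where "S = (\<Union>i<d. \<Union>j<d. Poly_Mapping.keys (\<alpha> $$ (i, j)))"
  \<comment> \<open>Values outside \<open>S\<close> do not matter; extending by an element of the alphabet makes the local rule
    an instance of the global one.\<close>
  define \<mu> where "\<mu> = (\<lambda>x. act_mod d \<alpha> (\<lambda>s. if s \<in> S then x s else (\<lambda>i\<in>{..<d}. rep 0)) 0)"
  have dflt: "(\<lambda>i\<in>{..<d}. rep 0) \<in> alphabet d" using zero_closed by (auto simp: alphabet_def)
  show ?thesis
    unfolding cellular_automaton_def
  proof (intro conjI exI[of _ S] exI[of _ \<mu>] ballI allI)
    show "act_mod d \<alpha> \<in> (UNIV \<rightarrow> alphabet d) \<rightarrow> UNIV \<rightarrow> alphabet d"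
      using act_mod_alphabet[OF \<alpha>] by auto
    show "finite S" unfolding S_def by auto
    show "\<mu> \<in> (S \<rightarrow>\<^sub>E alphabet d) \<rightarrow> alphabet d"
      unfolding \<mu>_def using dflt by (intro Pi_I act_mod_alphabet[OF \<alpha>]) auto
    fix c :: "'m \<Rightarrow> nat \<Rightarrow> 'a" and m
    have "act d \<alpha> c m j = act d \<alpha> (\<lambda>s. if s \<in> S then restrict (c \<circ> right_mult m) S s
        else (\<lambda>i\<in>{..<d}. rep 0)) 0 j" if "j < d" for j
      unfolding act_def linear_ext_def
      using that by (intro sum.cong refl) (auto simp: S_def right_mult_def)
    then show "act_mod d \<alpha> c m = \<mu> (restrict (c \<circ> right_mult m) S)"
      unfolding \<mu>_def act_mod_def by (intro restrict_ext) auto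
  qed
qed

text \<open>
  The automata of \<open>\<alpha>\<close> and \<open>\<beta>\<close> compose to the identity in one order because \<open>\<alpha> \<beta> = 1\<close>. Hence the
  automaton of \<open>\<alpha>\<close> is injective, so surjective, and the two are inverse to each other; comparing
  coefficients in the other order gives \<open>\<beta> \<alpha> = 1\<close>, up to the ideal.
\<close>

lemma surjunctive_one_sided_inverse_mod:
  fixes \<alpha> \<beta> :: "('m::monoid_add \<Rightarrow>\<^sub>0 'a) mat"
  assumes surj: "surjunctive TYPE('m)"
    and \<alpha>: "\<alpha> \<in> carrier_mat d d" "coeffs_closed d \<alpha>"
    and \<beta>: "\<beta> \<in> carrier_mat d d" "coeffs_closed d \<beta>"
    and inv: "\<alpha> * \<beta> = 1\<^sub>m d" and i: "i < d" and j: "j < d"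
  shows "Poly_Mapping.lookup ((\<beta> * \<alpha>) $$ (i, j)) s - Poly_Mapping.lookup (1\<^sub>m d $$ (i, j)) s \<in> I"
proof -
  let ?C = "(UNIV :: 'm set) \<rightarrow> alphabet d"
  have left: "act_mod d \<beta> (act_mod d \<alpha> c) = c" if c: "c \<in> ?C" for c
  proof
    fix m
    show "act_mod d \<beta> (act_mod d \<alpha> c) m = c m"
    proof (rule alphabet_eqI)
      show "act_mod d \<beta> (act_mod d \<alpha> c) m \<in> alphabet d" "c m \<in> alphabet d"
        using c by (auto intro!: act_mod_alphabet \<alpha> \<beta>)
      fix k assume k: "k < d"
      show "act_mod d \<beta> (act_mod d \<alpha> c) m k = c m k"
        using act_mod_act_mod[OF \<beta> \<alpha> _ k, of c m] c k rep_alphabet[of "c m" d k]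
        by (auto simp: inv act_one Pi_iff)
    qed
  qed
  have "inj_on (act_mod d \<alpha>) ?C"
    by (rule inj_on_inverseI[of _ "act_mod d \<beta>"]) (rule left)
  then have onto: "act_mod d \<alpha> ` ?C = ?C"
    using surjunctiveD surj finite_alphabet cellular_automaton_act_mod[OF \<alpha>(2)] by blast
  \<comment> \<open>The configuration \<open>\<delta>\<close> reads off the coefficient; \<open>c\<close> is its reduction to the alphabet.\<close>
  define \<delta> :: "'m \<Rightarrow> nat \<Rightarrow> 'a" where "\<delta> = (\<lambda>m i'. if m = s \<and> i' = i then 1 else 0)"
  define c where "c = (\<lambda>m. \<lambda>k\<in>{..<d}. rep (\<delta> m k))"
  have \<delta>: "\<delta> m k \<in> A" for m k by (simp add: \<delta>_def closed)
  have c: "c \<in> ?C" using \<delta> by (auto simp: c_def alphabet_def)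
  have \<delta>c: "\<delta> m k - c m k \<in> I" if "k < d" for m k using rep_diff[OF \<delta>] that by (simp add: c_def)
  obtain e where e: "e \<in> ?C" "c = act_mod d \<alpha> e" using onto c by blast
  have "act_mod d \<alpha> (act_mod d \<beta> c) = c" using left[OF e(1)] e(2) by simp
  then have "rep (act d (\<beta> * \<alpha>) c 0 j) = c 0 j"
    using act_mod_act_mod[OF \<alpha> \<beta> _ j, of c 0] c by (auto simp: Pi_iff)
  moreover have "c 0 j = rep (\<delta> 0 j)" using j by (simp add: c_def)
  moreover have "act d \<beta> \<delta> m k - act d \<beta> c m k \<in> I" if "k < d" for m k
    using \<delta>c that by (intro act_cong_mod \<beta>)
  then have "act d (\<beta> * \<alpha>) \<delta> 0 j - act d (\<beta> * \<alpha>) c 0 j \<in> I"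
    using j by (simp add: act_mult[OF \<alpha>(1) \<beta>(1) j] act_cong_mod \<alpha>)
  then have "rep (act d (\<beta> * \<alpha>) \<delta> 0 j) = rep (act d (\<beta> * \<alpha>) c 0 j)" by (rule rep_eqI)
  moreover have "act d (\<beta> * \<alpha>) \<delta> 0 j \<in> A"
    using \<delta> j by (simp add: act_mult[OF \<alpha>(1) \<beta>(1) j] act_closed \<alpha> \<beta>)
  ultimately have "act d (\<beta> * \<alpha>) \<delta> 0 j - \<delta> 0 j \<in> I" using \<delta> rep_eqD by metis
  moreover have "\<delta> 0 j = act d (1\<^sub>m d) \<delta> 0 j" using j by (simp add: act_one)
  ultimately show ?thesis unfolding \<delta>_def act_delta[OF i] by simp
qed

end

section \<open>Stable finiteness\<close>

theorem theorem1p1: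
  assumes "surjunctive TYPE('m::monoid_add)"
  shows "stably_finite TYPE('m \<Rightarrow>\<^sub>0 'k::field)"
  unfolding stably_finite_def directly_finite_def ring_mat_simps
proof (intro allI impI ballI)
  fix d and \<alpha> \<beta> :: "('m \<Rightarrow>\<^sub>0 'k) mat"
  assume \<alpha>: "\<alpha> \<in> carrier_mat d d" and \<beta>: "\<beta> \<in> carrier_mat d d" and inv: "\<alpha> * \<beta> = 1\<^sub>m d"
  show "\<beta> * \<alpha> = 1\<^sub>m d"
  proof (rule ccontr)
    assume "\<beta> * \<alpha> \<noteq> 1\<^sub>m d"
    moreover have "\<beta> * \<alpha> = 1\<^sub>m d"
      if "\<And>i j. i < d \<Longrightarrow> j < d \<Longrightarrow> (\<beta> * \<alpha>) $$ (i, j) = 1\<^sub>m d $$ (i, j)"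
      using that \<alpha> \<beta> by (intro eq_matI) (simp_all del: index_mult_mat(1) index_one_mat(1))
    ultimately obtain i j where ij: "i < d" "j < d" "(\<beta> * \<alpha>) $$ (i, j) \<noteq> 1\<^sub>m d $$ (i, j)"
      by blast
    then obtain s where s: "Poly_Mapping.lookup ((\<beta> * \<alpha>) $$ (i, j)) s \<noteq> Poly_Mapping.lookup (1\<^sub>m d $$ (i, j)) s"
      using poly_mapping_eqI[of "(\<beta> * \<alpha>) $$ (i, j)" "1\<^sub>m d $$ (i, j)"] by blast
    define r where "r = Poly_Mapping.lookup ((\<beta> * \<alpha>) $$ (i, j)) s - Poly_Mapping.lookup (1\<^sub>m d $$ (i, j)) s"
    define coeffs where "coeffs = (\<lambda>\<gamma> :: ('m \<Rightarrow>\<^sub>0 'k) mat. \<Union>k<d. \<Union>l<d.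
      Poly_Mapping.lookup (\<gamma> $$ (k, l)) ` Poly_Mapping.keys (\<gamma> $$ (k, l)))"
    have "finite (insert r (coeffs \<alpha> \<union> coeffs \<beta>))" unfolding coeffs_def by auto
    from finite_subset_finite_unit_quotients[OF this]
    obtain A where A: "r \<in> A" "coeffs \<alpha> \<subseteq> A" "coeffs \<beta> \<subseteq> A" and quot: "finite_unit_quotients A"
      by auto
    obtain I where I: "finite_quotient A I" "finite_quotient.unit_mod A I r"
      using quot A(1) s unfolding finite_unit_quotients_def r_def by auto
    interpret finite_quotient A I by fact
    have coeffs: "coeffs_closed d \<gamma>" if "coeffs \<gamma> \<subseteq> A" for \<gamma>
      unfolding coeffs_closed_def
    proof (intro allI impI)
      fix k l t assume kl: "k < d" "l < d"
      show "Poly_Mapping.lookup (\<gamma> $$ (k, l)) t \<in> A"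
      proof (cases "t \<in> Poly_Mapping.keys (\<gamma> $$ (k, l))")
        case True
        then have "Poly_Mapping.lookup (\<gamma> $$ (k, l)) t \<in> coeffs \<gamma>"
          using kl unfolding coeffs_def by blast
        then show ?thesis using that by blast
      next
        case False
        then show ?thesis using zero_closed by (simp add: in_keys_iff)
      qed
    qed
    have "r \<in> I"
      unfolding r_def using surjunctive_one_sided_inverse_mod[OF assms \<alpha> coeffs \<beta> coeffs inv] A ij
      by blast
    then show False using I(2) unit_mod_notin by blast
  qed
qed

end
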